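(* Let $m\geq 2$ be a positive integer and let $R\cong \prod_{i=1}^{m}R_{i}$, where for every $1\leq i\leq m$, $R_{i}$ is a local Artinian principal ideal ring that is not a field. Let $$M=\{I=I_1\times\cdots\times I_m\in V(In(R)) \mid I_i=0 \text{ or } I_i=R_i \text{ for every } 1\leq i\leq m\}.$$ Then the following statements hold: 1) $V(In(R))=V(In(R)_{SR})$. 2) For distinct $I,J\in M\subset V(In(R)_{SR})$: $IJ\in E(In(R)_{SR})$ if and only if either $I=J^{c}$, or both $IJ\notin E(In(R))$ and $IJ^{c}\notin E(In(R))$. 3) For distinct $I,J\in V(In(R)_{SR})\setminus M$: $IJ\in E(In(R)_{SR})$ if and only if $IJ\notin E(In(R))$. 4) For every $I\in V(In(R)_{SR})\setminus M$ and every $J\in M$: $IJ\in E(In(R)_{SR})$ if and only if $IJ\notin E(In(R))$ and $IJ^{c}\notin E(In(R))$.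
   Context: All rings are commutative with identity. The inclusion ideal graph $In(R)$ is the simple graph whose vertices are all non-trivial ideals of $R$ (ideals different from $0$ and $R$), two distinct vertices being adjacent if and only if one of them is properly contained in the other. A local Artinian principal ideal ring has only finitely many ideals, totally ordered by inclusion. Every ideal of $R=\prod_{i=1}^m R_i$ has the form $I_1\times\cdots\times I_m$ with $I_i$ an ideal of $R_i$. For $J=J_1\times\cdots\times J_m\in M$, $J^{c}=J_1^c\times\cdots\times J_m^c$ is the element of $M$ with $J_i^c=R_i$ if $J_i=0$ and $J_i^c=0$ if $J_i=R_i$. For a graph $G$, $V(G)$ and $E(G)$ denote the vertex and edge sets, and $uv\in E(G)$ means that $u$ and $v$ are adjacent in $G$ (so $IJ$ denotes a pair of vertices, not a product of ideals). $N(u)$ is the open neighborhood of $u$ and $d$ the distance in $G$. Two different vertices $u,v$ are mutually maximally distant if $d(v,w)\leq d(u,v)$ for every $w\in N(u)$ and $d(u,w)\leq d(u,v)$ for every $w\in N(v)$. The strong resolving graph $G_{SR}$ has as vertices those $u\in V(G)$ for which there is some $v\in V(G)$ such that $u,v$ are mutually maximally distant, and $uv\in E(G_{SR})$ if and only if $u$ and $v$ are mutually maximally distant in $G$. *)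

theory Defs
  imports
    "HOL-Algebra.Chinese_Remainder"
    "Graph_Theory.Pair_Digraph"
    "Graph_Theory.Shortest_Path"
begin

section \<open>Local Artinian principal ideal rings\<close>

locale local_ring = cring +
  assumes unique_maximalideal: "\<exists>!I. maximalideal I R"

locale artinian_ring = cring +
  assumes descending_chain:
    "\<lbrakk> \<And>n :: nat. ideal (I n) R; \<And>n. I (Suc n) \<subseteq> I n \<rbrakk> \<Longrightarrow> \<exists>n. \<forall>k\<ge>n. I k = I n"

locale principal_ideal_ring = cring +
  assumes every_principal: "ideal I R \<Longrightarrow> principalideal I R"

section \<open>Graphs\<close>

text \<open>A simple graph is a loop-free symmetric pair digraph: the edge \<open>uv\<close> is the pair of
  arcs \<open>(u, v)\<close> and \<open>(v, u)\<close>.\<close>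

definition neighborhood :: "'v pair_pre_digraph \<Rightarrow> 'v \<Rightarrow> 'v set" where
  "neighborhood G u = {w. (u, w) \<in> parcs G}"

text \<open>With unit weights the cost of a walk is its length; the distance is \<open>\<infinity>\<close> if there is
  no walk from \<open>u\<close> to \<open>v\<close>.\<close>

definition graph_dist :: "'v pair_pre_digraph \<Rightarrow> 'v \<Rightarrow> 'v \<Rightarrow> ereal" where
  "graph_dist G u v = wf_digraph.\<mu> (with_proj G) (\<lambda>_. 1) u v"

definition mutually_maximally_distant :: "'v pair_pre_digraph \<Rightarrow> 'v \<Rightarrow> 'v \<Rightarrow> bool" where
  "mutually_maximally_distant G u v \<longleftrightarrow>
     u \<in> pverts G \<and> v \<in> pverts G \<and> u \<noteq> v \<and>
     (\<forall>w \<in> neighborhood G u. graph_dist G v w \<le> graph_dist G u v) \<and>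
     (\<forall>w \<in> neighborhood G v. graph_dist G u w \<le> graph_dist G u v)"

definition strong_resolving_graph :: "'v pair_pre_digraph \<Rightarrow> 'v pair_pre_digraph" where
  "strong_resolving_graph G =
     \<lparr> pverts = {u \<in> pverts G. \<exists>v \<in> pverts G. mutually_maximally_distant G u v},
       parcs = {(u, v). mutually_maximally_distant G u v} \<rparr>"

definition inclusion_ideal_graph :: "('a, 'n) ring_scheme \<Rightarrow> 'a set pair_pre_digraph" where
  "inclusion_ideal_graph R =
    (let V = {I. ideal I R \<and> I \<noteq> {\<zero>\<^bsub>R\<^esub>} \<and> I \<noteq> carrier R}
     in \<lparr> pverts = V, parcs = {(I, J). I \<in> V \<and> J \<in> V \<and> (I \<subset> J \<or> J \<subset> I)} \<rparr>)"

section \<open>Ideals of a ring isomorphic to a product\<close>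

text \<open>Below, \<open>h\<close> is an isomorphism from \<open>R\<close> onto the product of the list of rings \<open>Rs\<close>, whose
  elements are lists. An ideal \<open>I\<close> of \<open>R\<close> is written \<open>I\<^sub>1 \<times> \<dots> \<times> I\<^sub>m\<close> if \<open>h\<close> maps it onto
  \<^term>\<open>listset Is\<close>, where \<open>Is\<close> is the list of the \<open>I\<^sub>i\<close>; positions are counted from 0.\<close>

definition ideal_factorization ::
    "('b, 'n) ring_scheme list \<Rightarrow> ('a \<Rightarrow> 'b list) \<Rightarrow> 'a set \<Rightarrow> 'b set list \<Rightarrow> bool" where
  "ideal_factorization Rs h I Is \<longleftrightarrow>
     length Is = length Rs \<and> (\<forall>i < length Rs. ideal (Is ! i) (Rs ! i)) \<and> h ` I = listset Is"

definition ideal_factors ::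
    "('b, 'n) ring_scheme list \<Rightarrow> ('a \<Rightarrow> 'b list) \<Rightarrow> 'a set \<Rightarrow> 'b set list" where
  "ideal_factors Rs h I = (THE Is. ideal_factorization Rs h I Is)"

definition zero_one_ideals ::
    "('a, 'k) ring_scheme \<Rightarrow> ('b, 'n) ring_scheme list \<Rightarrow> ('a \<Rightarrow> 'b list) \<Rightarrow> 'a set set" where
  "zero_one_ideals R Rs h =
     {I \<in> pverts (inclusion_ideal_graph R).
        \<exists>Is. ideal_factorization Rs h I Is \<and>
             (\<forall>i < length Rs. Is ! i = {\<zero>\<^bsub>Rs ! i\<^esub>} \<or> Is ! i = carrier (Rs ! i))}"

text \<open>\<open>J\<^sup>c\<close>; meaningful only for \<open>J\<close> in \<^const>\<open>zero_one_ideals\<close>.\<close>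

definition ideal_compl ::
    "('a, 'k) ring_scheme \<Rightarrow> ('b, 'n) ring_scheme list \<Rightarrow> ('a \<Rightarrow> 'b list) \<Rightarrow> 'a set \<Rightarrow> 'a set" where
  "ideal_compl R Rs h J =
     {x \<in> carrier R. h x \<in> listset
        (map2 (\<lambda>S A. if A = {\<zero>\<^bsub>S\<^esub>} then carrier S else {\<zero>\<^bsub>S\<^esub>}) Rs (ideal_factors Rs h J))}"

end

theory Submission
  imports Defs "HOL-Algebra.Ring_Divisibility"
begin

text \<open>The ideals of a local Artinian principal ideal ring are the powers of a nilpotent maximal
  ideal \<open>(p)\<close>, so the ideals of \<open>R\<close> form a product of chains, each with at least three elements.
  In the comparability graph of such a product (without top and bottom), incomparable vertices
  have a common neighbor, namely their infimum or supremum, unless they are complementary, and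
  complementary vertices are at distance 3. Hence complementary vertices are mutually maximally
  distant. Other incomparable vertices, at distance 2, are so unless one is adjacent to the
  complement of the other. For \<open>x < y\<close>, moving one coordinate of \<open>x\<close> to the top or one of \<open>y\<close> to
  the bottom yields a neighbor of one that is incomparable to the other, so adjacent vertices are
  never mutually maximally distant.\<close>

section \<open>Comparability graphs of products of chains\<close>

lemma (in pair_wf_digraph) graph_dist_le:
  "awalk u p v \<Longrightarrow> graph_dist G u v \<le> ereal (length p)"
  using min_cost_le_walk_cost[of u p v "\<lambda>_. 1"]
  by (simp add: graph_dist_def awalk_cost_def sum_list_triv)

lemma (in pair_wf_digraph) graph_dist_ge:
  assumes "\<And>p. awalk u p v \<Longrightarrow> n \<le> length p"
  shows "ereal n \<le> graph_dist G u v"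
  using assms unfolding graph_dist_def \<mu>_def
  by (intro INF_greatest) (auto simp: awalk_cost_def sum_list_triv)

text \<open>With \<open>V\<close> the nontrivial ideals ordered by inclusion this is
  \<open>inclusion_ideal_graph\<close>, so the graph arguments can be carried out for an abstract
  order.\<close>

definition comparability_graph :: "'a::order set \<Rightarrow> 'a pair_pre_digraph" where
  "comparability_graph V =
     \<lparr> pverts = V, parcs = {(x, y). x \<in> V \<and> y \<in> V \<and> (x < y \<or> y < x)} \<rparr>"

lemma comparability_graph_simps [simp]:
  "pverts (comparability_graph V) = V"
  "(x, y) \<in> parcs (comparability_graph V) \<longleftrightarrow> x \<in> V \<and> y \<in> V \<and> (x < y \<or> y < x)"
  by (simp_all add: comparability_graph_def)

text \<open>\<open>coord\<close>, \<open>le_iff\<close> and \<open>tuple\<close> identify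
  \<open>L\<close> with the product of the chains \<open>C i\<close>, without forcing the elements
  of \<open>L\<close> to be tuples. \<open>between\<close> gives every chain a third element, as for
  the ideals of a factor that is not a field.\<close>

locale chain_product =
  fixes L :: "'a::order set" and m :: nat and f :: "'a \<Rightarrow> nat \<Rightarrow> 'b::order"
    and C :: "nat \<Rightarrow> 'b set" and lo hi :: "nat \<Rightarrow> 'b"
  assumes two_factors: "2 \<le> m"
    and le_iff: "\<lbrakk> x \<in> L; y \<in> L \<rbrakk> \<Longrightarrow> x \<le> y \<longleftrightarrow> (\<forall>i<m. f x i \<le> f y i)"
    and coord: "\<lbrakk> x \<in> L; i < m \<rbrakk> \<Longrightarrow> f x i \<in> C i"
    and tuple: "(\<And>i. i < m \<Longrightarrow> g i \<in> C i) \<Longrightarrow> \<exists>x\<in>L. \<forall>i<m. f x i = g i"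
    and chain: "\<lbrakk> i < m; a \<in> C i; b \<in> C i \<rbrakk> \<Longrightarrow> a \<le> b \<or> b \<le> a"
    and lo_in: "i < m \<Longrightarrow> lo i \<in> C i" and hi_in: "i < m \<Longrightarrow> hi i \<in> C i"
    and lo_le: "\<lbrakk> i < m; a \<in> C i \<rbrakk> \<Longrightarrow> lo i \<le> a" and le_hi: "\<lbrakk> i < m; a \<in> C i \<rbrakk> \<Longrightarrow> a \<le> hi i"
    and between: "i < m \<Longrightarrow> \<exists>a\<in>C i. a \<noteq> lo i \<and> a \<noteq> hi i"
begin

definition V :: "'a set" where
  "V = {x \<in> L. (\<exists>i<m. f x i \<noteq> lo i) \<and> (\<exists>i<m. f x i \<noteq> hi i)}"

abbreviation \<Gamma> :: "'a pair_pre_digraph" where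
  "\<Gamma> \<equiv> comparability_graph V"

definition complementary :: "'a \<Rightarrow> 'a \<Rightarrow> bool" where
  "complementary x y \<longleftrightarrow>
     (\<forall>i<m. f x i = lo i \<and> f y i = hi i \<or> f x i = hi i \<and> f y i = lo i)"

lemma complementary_sym: "complementary x y \<Longrightarrow> complementary y x"
  by (auto simp: complementary_def)

lemma lo_neq_hi: "i < m \<Longrightarrow> lo i \<noteq> hi i"
  using between[of i] lo_le[of i] le_hi[of i] by (metis order_antisym)

lemma V_L: "x \<in> V \<Longrightarrow> x \<in> L"
  by (simp add: V_def)

lemma V_le: "\<lbrakk> x \<in> V; y \<in> V \<rbrakk> \<Longrightarrow> x \<le> y \<longleftrightarrow> (\<forall>i<m. f x i \<le> f y i)"
  by (simp add: V_def le_iff)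

lemma eqI: "\<lbrakk> x \<in> L; y \<in> L; \<And>i. i < m \<Longrightarrow> f x i = f y i \<rbrakk> \<Longrightarrow> x = y"
  by (simp add: le_iff order_antisym)

lemma V_I_lower:
  assumes "z \<in> L" "x \<in> V" "z \<le> x" "i < m" "f z i \<noteq> lo i"
  shows "z \<in> V"
proof -
  obtain j where j: "j < m" "f x j \<noteq> hi j"
    using assms(2) by (auto simp: V_def)
  have "f z j \<le> f x j"
    using assms j by (auto simp: V_def le_iff)
  then have "f z j \<noteq> hi j"
    using j le_hi[of j "f x j"] coord[of x j] assms(2) by (auto simp: V_def)
  then show ?thesis
    using assms j by (auto simp: V_def)
qed

lemma V_I_upper:
  assumes "z \<in> L" "x \<in> V" "x \<le> z" "i < m" "f z i \<noteq> hi i"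
  shows "z \<in> V"
proof -
  obtain j where j: "j < m" "f x j \<noteq> lo j"
    using assms(2) by (auto simp: V_def)
  have "f x j \<le> f z j"
    using assms j by (auto simp: V_def le_iff)
  then have "f z j \<noteq> lo j"
    using j lo_le[of j "f x j"] coord[of x j] assms(2) by (auto simp: V_def)
  then show ?thesis
    using assms j by (auto simp: V_def)
qed

lemma obtain_tuple:
  assumes "\<And>i. i < m \<Longrightarrow> g i \<in> C i"
  obtains x where "x \<in> L" "\<And>i. i < m \<Longrightarrow> f x i = g i"
  using tuple[of g] assms by blast

lemma update:
  assumes "x \<in> L" "j < m" "a \<in> C j"
  obtains z where "z \<in> L" "f z j = a" "\<And>i. \<lbrakk> i < m; i \<noteq> j \<rbrakk> \<Longrightarrow> f z i = f x i"
  using tuple[of "\<lambda>i. if i = j then a else f x i"] assms coord[OF assms(1)]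
  by (metis (mono_tags, lifting))

section \<open>Complementary pairs and common neighbors\<close>

lemma complementary_incomparable:
  assumes "x \<in> V" "y \<in> V" "complementary x y"
  shows "\<not> x \<le> y" "\<not> y \<le> x"
proof -
  have "\<not> x \<le> y" if xy: "x \<in> V" "y \<in> V" "complementary x y" for x y
  proof
    assume "x \<le> y"
    obtain i where i: "i < m" "f x i \<noteq> lo i"
      using xy(1) by (auto simp: V_def)
    then have "f x i = hi i" "f y i = lo i"
      using xy(3) by (auto simp: complementary_def)
    moreover have "f x i \<le> f y i"
      using \<open>x \<le> y\<close> V_le xy i by blast
    ultimately show False
      using i lo_neq_hi lo_le hi_in by (metis order_antisym)
  qed
  then show "\<not> x \<le> y" "\<not> y \<le> x"
    using assms complementary_sym by blast+
qed

lemma complementary_unique: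
  assumes "y \<in> L" "z \<in> L" "complementary x y" "complementary x z"
  shows "y = z"
  using assms lo_neq_hi unfolding complementary_def by (metis eqI)

lemma complementary_V:
  assumes "x \<in> V" "y \<in> L" "complementary x y"
  shows "y \<in> V"
proof -
  obtain i j where "i < m" "f x i \<noteq> lo i" "j < m" "f x j \<noteq> hi j"
    using assms(1) by (auto simp: V_def)
  then have "i < m" "f y i \<noteq> hi i" "j < m" "f y j \<noteq> lo j"
    using assms(3) lo_neq_hi unfolding complementary_def by metis+
  then show ?thesis
    using assms(2) by (auto simp: V_def)
qed

lemma ex_complementary:
  assumes "x \<in> V" "\<And>i. i < m \<Longrightarrow> f x i = lo i \<or> f x i = hi i"
  obtains y where "y \<in> V" "complementary x y"
proof -
  obtain y where y: "y \<in> L" "\<And>i. i < m \<Longrightarrow> f y i = (if f x i = lo i then hi i else lo i)"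
    by (rule obtain_tuple[of "\<lambda>i. if f x i = lo i then hi i else lo i"]) (auto simp: lo_in hi_in)
  then have "complementary x y"
    using assms(2) lo_neq_hi by (auto simp: complementary_def)
  then show thesis
    using that complementary_V assms(1) y(1) by blast
qed

text \<open>The infimum works if some coordinate is nonminimal in both. Otherwise one of the two is
  minimal at every coordinate, and failure of complementarity yields a coordinate at which neither
  is maximal, so the supremum is not the top. Incomparability makes the inequalities strict.\<close>

lemma incomparable_common_neighbor:
  assumes "x \<in> V" "y \<in> V" "\<not> x \<le> y" "\<not> y \<le> x" "\<not> complementary x y"
  shows "\<exists>z\<in>V. (z < x \<and> z < y) \<or> (x < z \<and> y < z)"
proof (cases "\<exists>i<m. f x i \<noteq> lo i \<and> f y i \<noteq> lo i")
  case True
  then obtain i where i: "i < m" "f x i \<noteq> lo i" "f y i \<noteq> lo i" by blast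
  obtain z where z: "z \<in> L" "\<And>i. i < m \<Longrightarrow> f z i = (if f x i \<le> f y i then f x i else f y i)"
    by (rule obtain_tuple[of "\<lambda>i. if f x i \<le> f y i then f x i else f y i"])
      (auto simp: coord V_L assms)
  have "f y k \<le> f x k \<or> f x k \<le> f y k" if "k < m" for k
    using chain[OF that] coord that assms V_L by blast
  then have le: "z \<le> x" "z \<le> y"
    using z le_iff V_L assms by auto
  then have "z < x" "z < y"
    using assms by (auto simp: less_le)
  moreover have "z \<in> V"
    using V_I_lower[OF z(1) assms(1) le(1) i(1)] i z(2) by auto
  ultimately show ?thesis by blast
next
  case False
  then obtain i where i: "i < m" "f x i \<noteq> hi i" "f y i \<noteq> hi i"
    using assms(5) lo_neq_hi unfolding complementary_def by metis
  obtain z where z: "z \<in> L" "\<And>i. i < m \<Longrightarrow> f z i = (if f x i \<le> f y i then f y i else f x i)"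
    by (rule obtain_tuple[of "\<lambda>i. if f x i \<le> f y i then f y i else f x i"])
      (auto simp: coord V_L assms)
  have "f y k \<le> f x k \<or> f x k \<le> f y k" if "k < m" for k
    using chain[OF that] coord that assms V_L by blast
  then have le: "x \<le> z" "y \<le> z"
    using z le_iff V_L assms by auto
  then have "x < z" "y < z"
    using assms by (auto simp: less_le)
  moreover have "z \<in> V"
    using V_I_upper[OF z(1) assms(1) le(1) i(1)] i z(2) by auto
  ultimately show ?thesis by blast
qed

text \<open>At each coordinate one of \<open>x\<close>, \<open>y\<close> is maximal and the other
  minimal, so a common upper bound is the top and a common lower bound the bottom, neither of which
  is in \<open>V\<close>. A \<open>z\<close> between \<open>x\<close> and \<open>y\<close> would
  make them comparable.\<close>

lemma complementary_no_common_neighbor: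
  assumes "x \<in> V" "y \<in> V" "complementary x y" "z \<in> V" "x \<le> z \<or> z \<le> x"
  shows "\<not> y \<le> z" "\<not> z \<le> y"
proof -
  have *: "\<forall>i<m. f z i = hi i" if "x \<le> z" "y \<le> z"
  proof (intro allI impI)
    fix i assume i: "i < m"
    have "hi i \<le> f z i"
      using that V_le assms i unfolding complementary_def by metis
    then show "f z i = hi i"
      using le_hi[OF i] coord i assms(4) V_L by (meson order_antisym)
  qed
  have **: "\<forall>i<m. f z i = lo i" if "z \<le> x" "z \<le> y"
  proof (intro allI impI)
    fix i assume i: "i < m"
    have "f z i \<le> lo i"
      using that V_le assms i unfolding complementary_def by metis
    then show "f z i = lo i"
      using lo_le[OF i] coord i assms(4) V_L by (meson order_antisym)
  qed
  show "\<not> y \<le> z" "\<not> z \<le> y"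
    using * ** assms complementary_incomparable[OF assms(1-3)] unfolding V_def
    by (blast dest: order_trans)+
qed

text \<open>The path \<open>x > z < w > y\<close>, where \<open>z\<close> and \<open>w\<close> arise from \<open>x\<close> and \<open>y\<close> by replacing one
  coordinate at which \<open>x\<close> is maximal and \<open>y\<close> minimal by a value strictly in between.\<close>

lemma complementary_path:
  assumes "x \<in> V" "y \<in> V" "complementary x y"
  shows "\<exists>z\<in>V. \<exists>w\<in>V. z < x \<and> z < w \<and> y < w"
proof -
  obtain i j where ij: "i < m" "f x i \<noteq> lo i" "j < m" "f x j \<noteq> hi j"
    using assms(1) by (auto simp: V_def)
  then have c: "f x i = hi i" "f y i = lo i" "f x j = lo j" "f y j = hi j" "i \<noteq> j"
    using assms(3) lo_neq_hi by (auto simp: complementary_def)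
  obtain a where a: "a \<in> C i" "a \<noteq> lo i" "a \<noteq> hi i"
    using between ij(1) by blast
  obtain w where w: "w \<in> L" "f w i = a" "\<And>k. \<lbrakk> k < m; k \<noteq> i \<rbrakk> \<Longrightarrow> f w k = f y k"
    using update[OF V_L[OF assms(2)] ij(1) a(1)] by blast
  \<comment> \<open>\<open>z\<close> is minimal away from \<open>i\<close>, hence below both
    \<open>x\<close> and \<open>w\<close>. It differs from \<open>x\<close> at \<open>i\<close>,
    where \<open>x\<close> is maximal, and from \<open>w\<close> at \<open>j\<close>, where
    \<open>w\<close> keeps the maximal value of \<open>y\<close>.\<close>
  obtain z where z: "z \<in> L" "\<And>k. k < m \<Longrightarrow> f z k = (if k = i then a else lo k)"
    by (rule obtain_tuple[of "\<lambda>k. if k = i then a else lo k"]) (auto simp: a lo_in)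
  have "z \<le> x" "z \<le> w"
    using z w c assms(1,2) V_L lo_le le_hi ij a coord by (auto simp: le_iff)
  moreover have "f z i \<noteq> f x i" "f z j \<noteq> f w j"
    using z(2)[OF ij(1)] z(2)[OF ij(3)] w(3)[OF ij(3)] c a(3) lo_neq_hi[OF ij(3)] by simp_all
  then have "z \<noteq> x" "z \<noteq> w"
    by auto
  moreover have "f y k \<le> f w k" if "k < m" for k
    using that w c lo_le[OF that] a by (cases "k = i") auto
  then have "y \<le> w"
    using w(1) assms(2) V_L le_iff by blast
  moreover have "y \<noteq> w"
    using w c a by auto
  moreover have "z \<in> V" "w \<in> V"
    using V_I_lower[OF z(1) assms(1) \<open>z \<le> x\<close> ij(1)] V_I_upper[OF w(1) assms(2) \<open>y \<le> w\<close> ij(1)] z w a ij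
    by auto
  ultimately show ?thesis
    by (auto simp: less_le)
qed

section \<open>Distances in the comparability graph\<close>

sublocale graph: pair_wf_digraph \<Gamma>
  by unfold_locales auto

lemma dist_self: "x \<in> V \<Longrightarrow> graph_dist \<Gamma> x x = 0"
  using graph.graph_dist_le[of x "[]" x] graph.graph_dist_ge[of x x 0]
  by (simp add: graph.awalk_Nil_iff flip: zero_ereal_def)

lemma dist_comparable:
  assumes "x \<in> V" "y \<in> V" "x < y \<or> y < x"
  shows "graph_dist \<Gamma> x y = 1"
proof (rule antisym)
  show "graph_dist \<Gamma> x y \<le> 1"
    using graph.graph_dist_le[of x "[(x, y)]" y] assms
    by (simp add: graph.awalk_simps flip: one_ereal_def)
  have "1 \<le> length p" if "graph.awalk x p y" for p
    using that assms by (cases p) (auto simp: graph.awalk_simps)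
  then show "1 \<le> graph_dist \<Gamma> x y"
    using graph.graph_dist_ge[of x y 1] by (simp flip: one_ereal_def)
qed

lemma awalk_incomparable:
  assumes "\<not> x \<le> y" "\<not> y \<le> x" "graph.awalk x p y"
  shows "2 \<le> length p"
proof -
  have "p \<noteq> []" "\<And>e. p \<noteq> [e]"
    using assms by (auto simp: graph.awalk_simps)
  then show ?thesis
    \<comment> \<open>The case rule of \<open>remdups_adj\<close> splits off the lists of length
      zero and one.\<close>
    by (cases p rule: remdups_adj.cases) auto
qed

lemma dist_incomparable:
  assumes "x \<in> V" "y \<in> V" "\<not> x \<le> y" "\<not> y \<le> x" "\<not> complementary x y"
  shows "graph_dist \<Gamma> x y = 2"
proof (rule antisym)
  obtain z where "z \<in> V" "(z < x \<and> z < y) \<or> (x < z \<and> y < z)"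
    using incomparable_common_neighbor[OF assms] by blast
  then show "graph_dist \<Gamma> x y \<le> 2"
    using graph.graph_dist_le[of x "[(x, z), (z, y)]" y] assms
    by (auto simp: graph.awalk_simps)
  show "2 \<le> graph_dist \<Gamma> x y"
    using graph.graph_dist_ge[of x y 2] awalk_incomparable[OF assms(3,4)] by simp
qed

lemma dist_complementary:
  assumes "x \<in> V" "y \<in> V" "complementary x y"
  shows "graph_dist \<Gamma> x y = 3"
proof (rule antisym)
  obtain z w where "z \<in> V" "w \<in> V" "z < x" "z < w" "y < w"
    using complementary_path[OF assms] by blast
  then show "graph_dist \<Gamma> x y \<le> 3"
    using graph.graph_dist_le[of x "[(x, z), (z, w), (w, y)]" y] assms
    by (auto simp: graph.awalk_simps)
  have "3 \<le> length p" if p: "graph.awalk x p y" for p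
  proof (rule ccontr)
    assume "\<not> 3 \<le> length p"
    then have "length p = 2"
      using awalk_incomparable[OF complementary_incomparable[OF assms] p] by simp
    \<comment> \<open>On a walk of length two the middle vertex \<open>snd d\<close> would be
      comparable to both ends.\<close>
    then obtain d e where "p = [d, e]"
      by (auto simp: numeral_2_eq_2 length_Suc_conv)
    then show False
      using p complementary_no_common_neighbor[OF assms, of "snd d"]
      by (cases d; cases e) (auto simp: graph.awalk_simps less_le)
  qed
  then show "3 \<le> graph_dist \<Gamma> x y"
    using graph.graph_dist_ge[of x y 3] by simp
qed

text \<open>Collects all distances, which are at most 3. The order of the tests is harmless, since
  complementary vertices are incomparable.\<close>

lemma dist_eq:
  assumes "x \<in> V" "y \<in> V"
  shows "graph_dist \<Gamma> x y =
    (if x = y then 0 else if x < y \<or> y < x then 1 else if complementary x y then 3 else 2)"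
  using assms dist_self dist_comparable dist_incomparable dist_complementary
  by (auto simp: less_le)

section \<open>Criterion for mutually maximally distant vertices\<close>

lemma less_neighbor_incomparable:
  assumes "x \<in> V" "y \<in> V" "x < y"
  shows "\<exists>z\<in>V. (x < z \<and> \<not> z \<le> y \<and> \<not> y \<le> z) \<or> (z < y \<and> \<not> z \<le> x \<and> \<not> x \<le> z)"
proof -
  have L: "x \<in> L" "y \<in> L"
    using assms V_L by auto
  have xy: "f x i \<le> f y i" if "i < m" for i
    using that assms V_le by (auto simp: less_le)
  have top: "\<not> hi i \<le> f y i" if "i < m" "f y i \<noteq> hi i" for i
    using that le_hi coord L by (metis order_antisym)
  have bot: "\<not> f x i \<le> lo i" if "i < m" "f x i \<noteq> lo i" for i
    using that lo_le coord L by (metis order_antisym)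
  \<comment> \<open>\<open>raise\<close> replaces coordinate \<open>j\<close> of \<open>x\<close> by
    the top: the result exceeds \<open>y\<close> at \<open>j\<close> but stays strictly below
    \<open>y\<close> at \<open>i\<close>. Dually, \<open>lower\<close> replaces coordinate
    \<open>j\<close> of \<open>y\<close> by the bottom. Either way a neighbor of one vertex arises
    that is incomparable to the other.\<close>
  consider (raise) i j where "i < m" "j < m" "i \<noteq> j" "f x i \<noteq> f y i" "f y j \<noteq> hi j"
    | (lower) i j where "i < m" "j < m" "i \<noteq> j" "f x i \<noteq> f y i" "f x j \<noteq> lo j"
  proof -
    obtain i where i: "i < m" "f x i \<noteq> f y i"
      using assms(3) eqI[OF L] by (metis less_irrefl)
    obtain k where k: "k < m" "k \<noteq> i"
    proof
      show "(if i = 0 then 1 else 0) < m" "(if i = 0 then 1 else 0) \<noteq> i"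
        using two_factors by auto
    qed
    obtain j where j: "j < m" "f y j \<noteq> hi j"
      using assms(2) by (auto simp: V_def)
    \<comment> \<open>If \<open>j = i\<close>, coordinate \<open>k\<close> decides: either
      \<open>y\<close> is not maximal there, or \<open>x\<close> is not minimal there, or
      \<open>x\<close> is minimal and \<open>y\<close> maximal, so that they differ at
      \<open>k\<close> and coordinate \<open>i\<close> can be raised.\<close>
    show thesis
      using raise[of i j] raise[of k i] lower[of i k] i j k lo_neq_hi[OF k(1)] raise[of i k]
      by metis
  qed
  then show ?thesis
  proof cases
    case raise
    obtain z where z: "z \<in> L" "f z j = hi j" "\<And>k. \<lbrakk> k < m; k \<noteq> j \<rbrakk> \<Longrightarrow> f z k = f x k"
      using update[OF L(1) raise(2) hi_in] raise(2) by blast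
    \<comment> \<open>As \<open>z\<close> agrees with \<open>x\<close> at \<open>i\<close>, this
      keeps \<open>z\<close> from lying above \<open>y\<close> and from being the top.\<close>
    have neq: "\<not> f y i \<le> f x i"
      using raise xy by (metis order_antisym)
    have "f x k \<le> f z k" if "k < m" for k
      using z that le_hi coord L by (cases "k = j") auto
    then have "x \<le> z"
      using le_iff z(1) L by blast
    moreover have "\<not> z \<le> y"
      using le_iff[OF z(1) L(2)] z(2) top raise by metis
    moreover have "\<not> y \<le> z"
      using le_iff[OF L(2) z(1)] z(3)[of i] neq raise by metis
    moreover have "f z i \<noteq> hi i"
      using neq z(3)[of i] le_hi coord L raise by metis
    then have "z \<in> V"
      using V_I_upper[OF z(1) assms(1) \<open>x \<le> z\<close>] raise by blast
    ultimately show ?thesis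
      using assms(3) by (auto simp: less_le)
  next
    case lower
    obtain z where z: "z \<in> L" "f z j = lo j" "\<And>k. \<lbrakk> k < m; k \<noteq> j \<rbrakk> \<Longrightarrow> f z k = f y k"
      using update[OF L(2) lower(2) lo_in] lower(2) by blast
    have neq: "\<not> f y i \<le> f x i"
      using lower xy by (metis order_antisym)
    have "f z k \<le> f y k" if "k < m" for k
      using z that lo_le coord L by (cases "k = j") auto
    then have "z \<le> y"
      using le_iff z(1) L by blast
    moreover have "\<not> x \<le> z"
      using le_iff[OF L(1) z(1)] z(2) bot lower by metis
    moreover have "\<not> z \<le> x"
      using le_iff[OF z(1) L(1)] z(3)[of i] neq lower by metis
    moreover have "f z i \<noteq> lo i"
      using neq z(3)[of i] lo_le coord L lower by metis
    then have "z \<in> V"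
      using V_I_lower[OF z(1) assms(2) \<open>z \<le> y\<close>] lower by blast
    ultimately show ?thesis
      using assms(3) by (auto simp: less_le)
  qed
qed

text \<open>Complementary vertices have the largest possible distance 3. At distance 2 the only
  obstruction is a neighbor of one vertex at distance 3 from the other, that is, the complement of
  that other vertex. At distance 1 \<open>less_neighbor_incomparable\<close> gives a neighbor that
  is farther away.\<close>

lemma mutually_maximally_distant_iff:
  assumes "x \<in> V" "y \<in> V" "x \<noteq> y"
  shows "mutually_maximally_distant \<Gamma> x y \<longleftrightarrow>
    complementary x y \<or> \<not> x \<le> y \<and> \<not> y \<le> x \<and>
      (\<forall>z\<in>V. complementary y z \<longrightarrow> \<not> x < z \<and> \<not> z < x) \<and>
      (\<forall>z\<in>V. complementary x z \<longrightarrow> \<not> y < z \<and> \<not> z < y)"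
proof -
  have iff: "mutually_maximally_distant \<Gamma> x y \<longleftrightarrow>
    (\<forall>z\<in>V. x < z \<or> z < x \<longrightarrow> graph_dist \<Gamma> y z \<le> graph_dist \<Gamma> x y) \<and>
    (\<forall>z\<in>V. y < z \<or> z < y \<longrightarrow> graph_dist \<Gamma> x z \<le> graph_dist \<Gamma> x y)"
    using assms by (auto simp: mutually_maximally_distant_def neighborhood_def)
  have le_2: "graph_dist \<Gamma> u v \<le> 2 \<longleftrightarrow> \<not> complementary u v" if "u \<in> V" "v \<in> V" for u v
    using that complementary_incomparable[OF that] by (auto simp: dist_eq less_le)
  have le_1: "graph_dist \<Gamma> u v \<le> 1 \<longleftrightarrow> u \<le> v \<or> v \<le> u" if "u \<in> V" "v \<in> V" for u v
    using that by (auto simp: dist_eq less_le)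
  have le_3: "graph_dist \<Gamma> u v \<le> 3" if "u \<in> V" "v \<in> V" for u v
    using that by (auto simp: dist_eq)
  consider "x < y \<or> y < x" | "complementary x y"
    | "\<not> x \<le> y" "\<not> y \<le> x" "\<not> complementary x y"
    using assms(3) by (auto simp: less_le)
  then show ?thesis
  proof cases
    case 1
    then have "\<not> complementary x y"
      using complementary_incomparable assms by (meson less_imp_le)
    moreover have "\<not> mutually_maximally_distant \<Gamma> x y"
      using 1 less_neighbor_incomparable[of x y] less_neighbor_incomparable[of y x] assms
      unfolding iff dist_comparable[OF assms(1,2) 1] by (metis le_1)
    ultimately show ?thesis
      using 1 by auto
  next
    case 2
    then show ?thesis
      using assms le_3 by (simp add: iff dist_complementary)
  next
    case 3
    then show ?thesis
      unfolding iff dist_incomparable[OF assms(1,2) 3] using assms le_2 by blast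
  qed
qed

text \<open>A coordinate with \<open>y\<close> nonminimal and \<open>u\<close> nonmaximal would have
  \<open>x\<close> maximal and \<open>v\<close> minimal, against \<open>x \<le> v\<close>; elsewhere
  \<open>f y i \<le> f u i\<close> is trivial. The converse exchanges the two pairs.\<close>

lemma complementary_le_iff:
  assumes "x \<in> V" "y \<in> V" "u \<in> V" "v \<in> V" "complementary x u" "complementary y v"
  shows "x \<le> v \<longleftrightarrow> y \<le> u"
proof -
  have "y \<le> u" if "x \<in> V" "y \<in> V" "u \<in> V" "v \<in> V" "complementary x u" "complementary y v" "x \<le> v"
    for x y u v
  proof -
    have "f y i \<le> f u i" if i: "i < m" for i
    proof (cases "f y i = lo i \<or> f u i = hi i")
      case True
      then show ?thesis
        using lo_le[OF i] le_hi[OF i] coord[OF V_L i] \<open>u \<in> V\<close> \<open>y \<in> V\<close> by metis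
    next
      case False
      then have "f x i = hi i" "f v i = lo i"
        using \<open>complementary x u\<close> \<open>complementary y v\<close> i by (auto simp: complementary_def)
      moreover have "f x i \<le> f v i"
        using \<open>x \<le> v\<close> \<open>x \<in> V\<close> \<open>v \<in> V\<close> V_le i by blast
      ultimately show ?thesis
        using lo_le[OF i hi_in[OF i]] lo_neq_hi[OF i] by (metis order_antisym)
    qed
    then show ?thesis
      using V_le \<open>u \<in> V\<close> \<open>y \<in> V\<close> by blast
  qed
  then show ?thesis
    using assms by blast
qed

text \<open>Lets the two conditions on complements in \<open>mutually_maximally_distant_iff\<close>
  collapse into one when both vertices have a complement.\<close>

lemma complementary_less_iff:
  assumes "x \<in> V" "y \<in> V" "u \<in> V" "v \<in> V" "complementary x u" "complementary y v"
  shows "x < v \<longleftrightarrow> y < u" "v < x \<longleftrightarrow> u < y"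
  using complementary_le_iff[OF assms]
    complementary_le_iff[OF assms(3,4,1,2) complementary_sym[OF assms(5)] complementary_sym[OF assms(6)]]
  by (auto simp: less_le_not_le)

lemma ex_mutually_maximally_distant:
  assumes "x \<in> V"
  shows "\<exists>y\<in>V. mutually_maximally_distant \<Gamma> x y"
proof (cases "\<forall>i<m. f x i = lo i \<or> f x i = hi i")
  case True
  then obtain y where y: "y \<in> V" "complementary x y"
    using ex_complementary[OF assms] by metis
  then have "x \<noteq> y"
    using complementary_incomparable assms by blast
  then show ?thesis
    using mutually_maximally_distant_iff[OF assms y(1)] y by blast
next
  case False
  then obtain j where j: "j < m" "f x j \<noteq> lo j" "f x j \<noteq> hi j" by blast
  obtain k where k: "k < m" "k \<noteq> j"
  proof
    show "(if j = 0 then 1 else 0) < m" "(if j = 0 then 1 else 0) \<noteq> j"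
      using two_factors by auto
  qed
  have no_compl: "\<not> complementary x z" for z
    using j by (auto simp: complementary_def)
  have xC: "f x j \<in> C j" "f x k \<in> C k"
    using coord V_L assms j k by auto
  obtain b where b: "b \<in> C k" "b \<noteq> lo k" "b \<noteq> hi k"
    using between[OF k(1)] by blast
  \<comment> \<open>Coordinates \<open>j\<close> and \<open>k\<close> have to pull in opposite
    directions. If \<open>f x k\<close> is minimal, \<open>p\<close> lies below \<open>f x j\<close>
    and \<open>q = b\<close> above \<open>f x k\<close>; otherwise \<open>p\<close> lies above and
    \<open>q\<close> below, with \<open>q = b\<close> if \<open>f x k\<close> is maximal. The value
    \<open>b\<close> keeps \<open>y\<close> from having a complement.\<close>
  define p q where "p = (if f x k = lo k then lo j else hi j)"
    and "q = (if f x k = lo k \<or> f x k = hi k then b else lo k)"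
  obtain y where y: "y \<in> L" "\<And>i. i < m \<Longrightarrow> f y i = (if i = j then p else if i = k then q else lo i)"
    by (rule obtain_tuple[of "\<lambda>i. if i = j then p else if i = k then q else lo i"])
      (auto simp: p_def q_def b lo_in hi_in j k)
  have yj: "f y j = p" and yk: "f y k = q"
    using y(2) j k by auto
  have strict: "\<not> f x j \<le> lo j" "\<not> hi j \<le> f x j" "\<not> b \<le> lo k" "\<not> hi k \<le> b"
    using j b k xC lo_le le_hi order_antisym by blast+
  have low: "\<not> f x k \<le> lo k" if "f x k \<noteq> lo k"
    using that k xC lo_le order_antisym by blast
  have "(\<not> f x j \<le> p \<or> \<not> f x k \<le> q) \<and> (\<not> p \<le> f x j \<or> \<not> q \<le> f x k)"
    using strict low by (auto simp: p_def q_def)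
  then have "\<not> x \<le> y" "\<not> y \<le> x"
    using le_iff[OF V_L[OF assms] y(1)] le_iff[OF y(1) V_L[OF assms]] yj yk j(1) k(1)
    by blast+
  moreover have "(p \<noteq> lo j \<or> q \<noteq> lo k) \<and> (p \<noteq> hi j \<or> q \<noteq> hi k)"
    using b lo_neq_hi[OF j(1)] lo_neq_hi[OF k(1)] by (auto simp: p_def q_def)
  then have "y \<in> V"
    unfolding V_def using y(1) yj yk j(1) k(1) by blast
  \<comment> \<open>A complement of \<open>y\<close> can exist only if \<open>f x k\<close> is
    strictly between the ends. It is then minimal at \<open>j\<close> and maximal at
    \<open>k\<close>, hence incomparable to \<open>x\<close>.\<close>
  moreover have "\<not> x < z \<and> \<not> z < x" if "z \<in> V" "complementary y z" for z
  proof -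
    have z: "p = lo j \<and> f z j = hi j \<or> p = hi j \<and> f z j = lo j"
      "q = lo k \<and> f z k = hi k \<or> q = hi k \<and> f z k = lo k"
      using that(2) j k yj yk unfolding complementary_def by metis+
    then have xk: "f x k \<noteq> lo k" "f x k \<noteq> hi k"
      using b by (auto simp: q_def)
    then have "f z j = lo j" "f z k = hi k"
      using z lo_neq_hi[OF j(1)] lo_neq_hi[OF k(1)] by (auto simp: p_def q_def)
    then have "\<not> f x j \<le> f z j" "\<not> f z k \<le> f x k"
      using j xk xC lo_le[OF j(1)] le_hi[OF k(1)] by (metis order_antisym)+
    then show ?thesis
      using V_le[OF assms that(1)] V_le[OF that(1) assms] j k by (auto simp: less_le)
  qed
  ultimately show ?thesis
    using mutually_maximally_distant_iff[OF assms \<open>y \<in> V\<close>] no_compl by blast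
qed

text \<open>Within \<open>V\<close> these are exactly the vertices that have a complement; for
  ideals they form \<open>M\<close>.\<close>

definition extremal :: "'a \<Rightarrow> bool" where
  "extremal x \<longleftrightarrow> (\<forall>i<m. f x i = lo i \<or> f x i = hi i)"

lemma complementary_extremal: "complementary x y \<Longrightarrow> extremal x" "complementary x y \<Longrightarrow> extremal y"
  by (auto simp: complementary_def extremal_def)

lemma mutually_maximally_distant_non_extremal:
  assumes "x \<in> V" "y \<in> V" "x \<noteq> y" "\<not> extremal x" "\<not> extremal y"
  shows "mutually_maximally_distant \<Gamma> x y \<longleftrightarrow> (x, y) \<notin> parcs \<Gamma>"
  using mutually_maximally_distant_iff[OF assms(1-3)] assms complementary_extremal
  by (auto simp: less_le)

text \<open>Only \<open>y\<close> has a complement, namely the unique \<open>y'\<close>, so one of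
  the two conditions on complements is vacuous and the other speaks of \<open>y'\<close>
  alone.\<close>

lemma mutually_maximally_distant_mixed:
  assumes "x \<in> V" "y \<in> V" "\<not> extremal x" "y' \<in> V" "complementary y y'"
  shows "mutually_maximally_distant \<Gamma> x y \<longleftrightarrow> (x, y) \<notin> parcs \<Gamma> \<and> (x, y') \<notin> parcs \<Gamma>"
proof -
  have "x \<noteq> y"
    using assms complementary_extremal by blast
  have no_compl: "\<not> complementary x z" for z
    using assms(3) complementary_extremal by blast
  have "complementary y z \<longleftrightarrow> z = y'" if "z \<in> V" for z
    using assms(4,5) complementary_unique that V_L by blast
  then show ?thesis
    using mutually_maximally_distant_iff[OF assms(1,2) \<open>x \<noteq> y\<close>] assms no_compl \<open>x \<noteq> y\<close>
    by (auto simp: less_le)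
qed

lemma mutually_maximally_distant_extremal:
  assumes "x \<in> V" "y \<in> V" "x \<noteq> y" "x' \<in> V" "complementary x x'" "y' \<in> V" "complementary y y'"
  shows "mutually_maximally_distant \<Gamma> x y \<longleftrightarrow>
    x = y' \<or> (x, y) \<notin> parcs \<Gamma> \<and> (x, y') \<notin> parcs \<Gamma>"
proof -
  have compl: "complementary y z \<longleftrightarrow> z = y'" "complementary x z \<longleftrightarrow> z = x'" if "z \<in> V" for z
    using assms(4-7) complementary_unique that V_L by blast+
  have "complementary x y \<longleftrightarrow> x = y'"
    using compl(1)[OF assms(1)] complementary_sym by blast
  then show ?thesis
    using mutually_maximally_distant_iff[OF assms(1-3)] assms compl
      complementary_less_iff[OF assms(1,2,4,6,5,7)]
    by (auto simp: less_le)
qed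

end

section \<open>Ideals of local Artinian principal ideal rings\<close>

text \<open>Zorn's lemma for the ideals above \<open>I\<close>; properness is expressed by
  \<open>\<one> \<notin> J\<close>, which the union of a chain inherits.\<close>

lemma (in ring) maximalideal_above:
  assumes "ideal I R" "I \<noteq> carrier R"
  shows "\<exists>M. maximalideal M R \<and> I \<subseteq> M"
proof -
  let ?A = "{J. ideal J R \<and> I \<subseteq> J \<and> \<one> \<notin> J}"
  have "\<exists>M\<in>?A. \<forall>J\<in>?A. M \<subseteq> J \<longrightarrow> J = M"
  proof (rule subset_Zorn_nonempty)
    show "?A \<noteq> {}"
      using assms ideal.one_imp_carrier by blast
  next
    fix \<C> assume C: "\<C> \<noteq> {}" "subset.chain ?A \<C>"
    then have sub: "\<C> \<subseteq> ?A"
      by (simp add: subset_chain_def)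
    have "subset.chain {J. ideal J R} \<C>"
      using C(2) sub unfolding subset_chain_def by blast
    then have "ideal (\<Union>\<C>) R"
      using chain_Union_is_ideal[of \<C>] C(1) by simp
    moreover have "I \<subseteq> \<Union>\<C>" "\<one> \<notin> \<Union>\<C>"
      using sub C(1) by blast+
    ultimately show "\<Union>\<C> \<in> ?A"
      by simp
  qed
  then obtain M where M: "M \<in> ?A" and max: "\<forall>J\<in>?A. M \<subseteq> J \<longrightarrow> J = M" ..
  have "maximalideal M R"
  proof (rule maximalidealI)
    fix J assume J: "ideal J R" "M \<subseteq> J"
    show "J = M \<or> J = carrier R"
    proof (cases "\<one> \<in> J")
      case True
      then show ?thesis
        using ideal.one_imp_carrier[OF J(1)] by simp
    next
      case False
      then have "J \<in> ?A"
        using J M by auto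
      then show ?thesis
        using max J(2) by simp
    qed
  qed (use M in auto)
  then show ?thesis
    using M by auto
qed

lemma (in cring) not_Unit_in_maximalideal:
  assumes "a \<in> carrier R" "a \<notin> Units R"
  shows "\<exists>M. maximalideal M R \<and> a \<in> M"
proof -
  have "PIdl a \<noteq> carrier R"
    using ideal_eq_carrier_iff[OF assms(1)] assms(2) by auto
  then show ?thesis
    using maximalideal_above[OF cgenideal_ideal[OF assms(1)]] cgenideal_self[OF assms(1)] by blast
qed

lemma (in principal_ideal_ring) ideal_eq_PIdl:
  assumes "ideal I R"
  obtains a where "a \<in> carrier R" "I = PIdl a"
  using principalideal.generate[OF every_principal[OF assms]] cgenideal_eq_genideal by metis

lemma (in cring) PIdl_Unit_mult:
  assumes "u \<in> Units R" "a \<in> carrier R"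
  shows "PIdl (u \<otimes> a) = PIdl a"
proof -
  have "u \<otimes> a \<sim> a"
  proof (rule associatedI2')
    show "u \<otimes> a = a \<otimes> u" using assms m_comm by blast
  qed (use assms in auto)
  then show ?thesis
    using associated_iff_same_ideal assms by auto
qed

section \<open>Powers of a generator of the maximal ideal\<close>

locale local_artinian_pir = local_ring R + artinian_ring R + principal_ideal_ring R
  for R (structure)
begin

text \<open>\<open>p\<close> generates the unique maximal ideal, which contains every nonunit. The
  descending ideals \<open>PIdl (p [^] n)\<close> become stationary, and then a Nakayama argument
  with the unit \<open>\<one> \<ominus> r \<otimes> p\<close> forces
  \<open>p [^] n = \<zero>\<close>.\<close>

lemma uniformizer:
  obtains p and n :: nat where "p \<in> carrier R" "carrier R - Units R \<subseteq> PIdl p" "p [^] n = \<zero>"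
proof -
  obtain M where M: "maximalideal M R" and unique: "\<And>N. maximalideal N R \<Longrightarrow> N = M"
    using unique_maximalideal by blast
  interpret M: maximalideal M R by (rule M)
  obtain p where p: "p \<in> carrier R" "M = PIdl p"
    using ideal_eq_PIdl[OF M.is_ideal] by blast
  have nonunit: "a \<in> M" if "a \<in> carrier R" "a \<notin> Units R" for a
    using not_Unit_in_maximalideal[OF that] unique by blast
  have "PIdl (p [^] Suc n) \<subseteq> PIdl (p [^] n)" for n :: nat
    using to_contain_is_to_divide[of "p [^] n" "p [^] Suc n"] p by auto
  then obtain n :: nat where "PIdl (p [^] Suc n) = PIdl (p [^] n)"
    using descending_chain[of "\<lambda>n. PIdl (p [^] n)"] cgenideal_ideal p(1)
    by (metis le_Suc_eq nat_pow_closed order_refl)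
  then have "p [^] n \<in> PIdl (p [^] Suc n)"
    using cgenideal_self p(1) by simp
  then obtain r where r: "r \<in> carrier R" "p [^] n = r \<otimes> p [^] Suc n"
    by (auto simp: cgenideal_def)
  define u where "u = \<one> \<ominus> r \<otimes> p"
  have u: "u \<in> carrier R"
    using p r by (simp add: u_def)
  have "r \<otimes> p \<in> M"
    using M.I_l_closed cgenideal_self p r(1) by simp
  moreover have "u \<oplus> r \<otimes> p = \<one>"
    unfolding u_def using p r(1) by algebra
  ultimately have "u \<notin> M"
    using M.a_closed M.one_imp_carrier M.I_notcarr by metis
  then have "u \<in> Units R"
    using nonunit u by blast
  moreover have "u \<otimes> p [^] n = \<zero>"
  proof -
    have "u \<otimes> p [^] n = p [^] n \<ominus> r \<otimes> (p [^] n \<otimes> p)"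
      unfolding u_def using p r(1) nat_pow_closed[OF p(1), of n] by algebra
    also have "\<dots> = \<zero>"
      using r p by (simp add: r_neg minus_eq)
    finally show ?thesis .
  qed
  ultimately have "p [^] n = \<zero>"
    using p(1) by (metis Units_inv_closed Units_l_inv Units_closed l_one m_assoc nat_pow_closed r_null)
  then show thesis
    using that p nonunit by blast
qed

text \<open>Every ideal is \<open>PIdl (p [^] k)\<close> for some \<open>k\<close>, and these
  decrease as \<open>k\<close> grows.\<close>

lemma ideals_chain:
  assumes "ideal I R" "ideal J R"
  shows "I \<subseteq> J \<or> J \<subseteq> I"
proof -
  obtain p and n :: nat where p: "p \<in> carrier R" "carrier R - Units R \<subseteq> PIdl p"
    "p [^] n = \<zero>"
    by (rule uniformizer)
  \<comment> \<open>A factor \<open>p\<close> is split off as long as the cofactor is a nonunit, at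
    most \<open>l\<close> times. For \<open>l = n\<close> the second alternative means
    \<open>a = \<zero>\<close>, which is \<open>p [^] n\<close>.\<close>
  have factor: "(\<exists>k<l. \<exists>u\<in>Units R. a = u \<otimes> p [^] k) \<or> (\<exists>b\<in>carrier R. a = b \<otimes> p [^] l)"
    if "a \<in> carrier R" for a and l :: nat
  proof (induction l)
    case 0
    then show ?case
      using that by auto
  next
    case (Suc l)
    show ?case
    proof (cases "\<exists>k<Suc l. \<exists>u\<in>Units R. a = u \<otimes> p [^] k")
      case False
      then obtain b where b: "b \<in> carrier R" "a = b \<otimes> p [^] l" "b \<notin> Units R"
        using Suc by (metis lessI less_Suc_eq)
      then obtain c where c: "c \<in> carrier R" "b = c \<otimes> p"
        using p(2) by (auto simp: cgenideal_def)
      then have "a = c \<otimes> p [^] Suc l"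
        using b p(1) by (simp add: m_assoc m_comm)
      then show ?thesis
        using c by blast
    qed simp
  qed
  have pow: "\<exists>k::nat. I = PIdl (p [^] k)" if I: "ideal I R" for I
  proof -
    obtain a where a: "a \<in> carrier R" "I = PIdl a"
      using ideal_eq_PIdl[OF I] by blast
    from factor[OF a(1), of n] show ?thesis
    proof (elim disjE exE conjE bexE)
      fix k u
      assume "u \<in> Units R" "a = u \<otimes> p [^] (k::nat)"
      then show ?thesis
        using PIdl_Unit_mult[of u "p [^] k"] p(1) a(2) by auto
    next
      fix b
      assume "b \<in> carrier R" "a = b \<otimes> p [^] n"
      then show ?thesis
        using p(3) a(2) by (intro exI[of _ n]) simp
    qed
  qed
  obtain k l :: nat where "I = PIdl (p [^] k)" "J = PIdl (p [^] l)"
    using pow assms by blast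
  moreover have "PIdl (p [^] (i + j)) \<subseteq> PIdl (p [^] i)" for i j :: nat
    using to_contain_is_to_divide[of "p [^] i" "p [^] (i + j)"] p(1)
    by (auto simp flip: nat_pow_mult)
  ultimately show ?thesis
    by (metis le_add_diff_inverse nat_le_linear)
qed

lemma carrier_neq_zero: "carrier R \<noteq> {\<zero>}"
proof -
  obtain M where "maximalideal M R"
    using unique_maximalideal by blast
  then interpret M: maximalideal M R .
  show ?thesis
    using M.I_notcarr M.zero_closed M.a_subset by auto
qed

text \<open>A nonzero commutative ring with only trivial ideals is a field. This supplies
  \<open>between\<close> for the chains of ideals.\<close>

lemma ex_nontrivial_ideal:
  assumes "\<not> field R"
  shows "\<exists>I. ideal I R \<and> I \<noteq> {\<zero>} \<and> I \<noteq> carrier R"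
  using trivialideals_fieldI[OF carrier_neq_zero] assms zeroideal oneideal by blast

end

section \<open>Ideals of finite products\<close>

lemma listset_iff: "xs \<in> listset As \<longleftrightarrow> length xs = length As \<and> (\<forall>i<length As. xs ! i \<in> As ! i)"
proof (induction As arbitrary: xs)
  case (Cons A As)
  then show ?case
    by (cases xs) (auto simp: set_Cons_def less_Suc_eq_0_disj)
qed simp

lemma RDirProd_list_Cons_mult_add:
  assumes "x \<in> carrier R" "xs \<in> carrier (RDirProd_list Rs)" "y \<in> carrier R" "ys \<in> carrier (RDirProd_list Rs)"
  shows "(x # xs) \<otimes>\<^bsub>RDirProd_list (R # Rs)\<^esub> (y # ys) = (x \<otimes>\<^bsub>R\<^esub> y) # (xs \<otimes>\<^bsub>RDirProd_list Rs\<^esub> ys)"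
    and "(x # xs) \<oplus>\<^bsub>RDirProd_list (R # Rs)\<^esub> (y # ys) = (x \<oplus>\<^bsub>R\<^esub> y) # (xs \<oplus>\<^bsub>RDirProd_list Rs\<^esub> ys)"
proof -
  have "(x, xs) \<in> carrier (RDirProd R (RDirProd_list Rs))" "(y, ys) \<in> carrier (RDirProd R (RDirProd_list Rs))"
    using assms by (simp_all add: RDirProd_carrier)
  from ring_hom_memE(2,3)[OF RDirProd_list_hom1 this]
  show "(x # xs) \<otimes>\<^bsub>RDirProd_list (R # Rs)\<^esub> (y # ys) = (x \<otimes>\<^bsub>R\<^esub> y) # (xs \<otimes>\<^bsub>RDirProd_list Rs\<^esub> ys)"
    and "(x # xs) \<oplus>\<^bsub>RDirProd_list (R # Rs)\<^esub> (y # ys) = (x \<oplus>\<^bsub>R\<^esub> y) # (xs \<oplus>\<^bsub>RDirProd_list Rs\<^esub> ys)"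
    by (simp_all add: RDirProd_def DirProd_def monoid.defs)
qed

lemma RDirProd_list_nth_hom:
  "i < length Rs \<Longrightarrow> (\<lambda>xs. xs ! i) \<in> ring_hom (RDirProd_list Rs) (Rs ! i)"
proof (induction Rs arbitrary: i)
  case (Cons R Rs)
  show ?case
  proof (cases i)
    case 0
    show ?thesis
      by (rule ring_hom_memI)
        (auto simp: 0 RDirProd_list_carrier RDirProd_list_Cons_mult_add RDirProd_list_one)
  next
    case (Suc j)
    then have hom: "(\<lambda>xs. xs ! j) \<in> ring_hom (RDirProd_list Rs) (Rs ! j)"
      using Cons by simp
    show ?thesis
      by (rule ring_hom_memI)
        (use ring_hom_memE[OF hom] in
          \<open>auto simp: Suc RDirProd_list_carrier RDirProd_list_Cons_mult_add RDirProd_list_one\<close>)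
  qed
qed simp

section \<open>Coordinates on a ring isomorphic to a product\<close>

locale ring_product_iso = R: cring R for R :: "('a, 'k) ring_scheme" (structure) +
  fixes m :: nat and Rs :: "('b, 'n) ring_scheme list" and h :: "'a \<Rightarrow> 'b list"
  assumes len: "length Rs = m" and pos: "0 < m"
    and factor_cring: "i < m \<Longrightarrow> cring (Rs ! i)"
    and iso: "h \<in> ring_iso R (RDirProd_list Rs)"
begin

lemma proj_hom: "i < m \<Longrightarrow> ring_hom_ring R (Rs ! i) (\<lambda>x. h x ! i)"
proof (rule ring_hom_ringI2)
  assume i: "i < m"
  have "(\<lambda>xs. xs ! i) \<in> ring_hom (RDirProd_list Rs) (Rs ! i)"
    using i len by (intro RDirProd_list_nth_hom) simp
  then show "(\<lambda>x. h x ! i) \<in> ring_hom R (Rs ! i)"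
    using ring_hom_trans[of h R "RDirProd_list Rs"] iso by (simp add: ring_iso_def comp_def)
qed (use factor_cring in \<open>auto simp: R.ring_axioms cring_def\<close>)

lemma length_h: "x \<in> carrier R \<Longrightarrow> length (h x) = m"
  using ring_iso_memE(1)[OF iso] RDirProd_list_carrier_mem(1) len by blast

lemma h_eqI:
  assumes "x \<in> carrier R" "y \<in> carrier R" "\<And>i. i < m \<Longrightarrow> h x ! i = h y ! i"
  shows "x = y"
proof -
  have "h x = h y"
    using assms length_h by (intro nth_equalityI) auto
  then show ?thesis
    using ring_iso_memE(5)[OF iso] assms(1,2) by (auto simp: bij_betw_def inj_on_def)
qed

lemma ex_tuple:
  assumes "\<And>i. i < m \<Longrightarrow> a i \<in> carrier (Rs ! i)"
  shows "\<exists>x\<in>carrier R. \<forall>i<m. h x ! i = a i"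
proof -
  have "map a [0..<m] \<in> carrier (RDirProd_list Rs)"
    using assms len by (intro RDirProd_list_carrier_memI) auto
  then obtain x where "x \<in> carrier R" "h x = map a [0..<m]"
    using ring_iso_memE(5)[OF iso] by (metis bij_betw_def imageE)
  then show ?thesis
    by (intro bexI[of _ x]) auto
qed

lemma surj_coordinate:
  assumes "i < m" "b \<in> carrier (Rs ! i)"
  shows "\<exists>x\<in>carrier R. h x ! i = b"
proof -
  have "(if j = i then b else \<zero>\<^bsub>Rs ! j\<^esub>) \<in> carrier (Rs ! j)" if "j < m" for j
    using assms factor_cring[OF that] by (auto simp: cring.cring_simprules)
  then obtain x where "x \<in> carrier R" "\<forall>j<m. h x ! j = (if j = i then b else \<zero>\<^bsub>Rs ! j\<^esub>)"
    using ex_tuple[of "\<lambda>j. if j = i then b else \<zero>\<^bsub>Rs ! j\<^esub>"] by blast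
  then show ?thesis
    using assms(1) by (intro bexI[of _ x]) auto
qed

section \<open>Ideals as products of their coordinate images\<close>

lemma ideal_factorization_iff:
  assumes "I \<subseteq> carrier R"
  shows "ideal_factorization Rs h I Is \<longleftrightarrow>
    length Is = m \<and> (\<forall>i<m. ideal (Is ! i) (Rs ! i)) \<and> I = {x \<in> carrier R. \<forall>i<m. h x ! i \<in> Is ! i}"
proof -
  \<comment> \<open>\<open>listset Is\<close> lies in the image of \<open>h\<close>, which is
    injective on \<open>carrier R\<close>, so the equality can be tested on preimages.\<close>
  have "h ` I = listset Is \<longleftrightarrow> I = {x \<in> carrier R. \<forall>i<m. h x ! i \<in> Is ! i}"
    if "length Is = m" "\<forall>i<m. ideal (Is ! i) (Rs ! i)"
  proof -
    have sub: "Is ! i \<subseteq> carrier (Rs ! i)" if "i < m" for i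
      using \<open>\<forall>i<m. ideal (Is ! i) (Rs ! i)\<close> that
      by (simp add: additive_subgroup.a_subset ideal.axioms(1))
    have bij: "bij_betw h (carrier R) (carrier (RDirProd_list Rs))"
      using iso by (rule ring_iso_memE(5))
    have "xs \<in> carrier (RDirProd_list Rs)" if "xs \<in> listset Is" for xs
      using that sub \<open>length Is = m\<close> len
      by (intro RDirProd_list_carrier_memI) (auto simp: listset_iff)
    then have "listset Is \<subseteq> h ` carrier R"
      using bij by (auto simp: bij_betw_def)
    then have "listset Is = h ` {x \<in> carrier R. h x \<in> listset Is}"
      by auto
    moreover have "{x \<in> carrier R. h x \<in> listset Is} = {x \<in> carrier R. \<forall>i<m. h x ! i \<in> Is ! i}"
      using length_h that(1) by (auto simp: listset_iff)
    ultimately have "listset Is = h ` {x \<in> carrier R. \<forall>i<m. h x ! i \<in> Is ! i}"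
      by simp
    then show ?thesis
      using inj_on_image_eq_iff[OF bij_betw_imp_inj_on[OF bij] assms, of "{x \<in> carrier R. \<forall>i<m. h x ! i \<in> Is ! i}"]
      by simp
  qed
  then show ?thesis
    using len by (auto simp: ideal_factorization_def)
qed

lemma ideal_tuple:
  assumes "\<And>i. i < m \<Longrightarrow> ideal (A i) (Rs ! i)"
  shows "ideal {x \<in> carrier R. \<forall>i<m. h x ! i \<in> A i} R"
proof -
  \<comment> \<open>This intersects preimages of ideals under the projections; \<open>pos\<close>
    makes the index set nonempty.\<close>
  have "ideal (\<Inter>i<m. {x \<in> carrier R. h x ! i \<in> A i}) R"
    using ring_hom_ring.ideal_vimage[OF proj_hom] assms pos by (intro R.i_Intersect) auto
  also have "(\<Inter>i<m. {x \<in> carrier R. h x ! i \<in> A i}) = {x \<in> carrier R. \<forall>i<m. h x ! i \<in> A i}"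
    using pos by auto
  finally show ?thesis .
qed

text \<open>Closure under multiplication rests on surjectivity of the projection: a multiplier in
  \<open>Rs ! i\<close> is lifted to \<open>R\<close>.\<close>

lemma ideal_image:
  assumes "ideal I R" "i < m"
  shows "ideal ((\<lambda>x. h x ! i) ` I) (Rs ! i)"
proof -
  interpret I: ideal I R by fact
  interpret S: cring "Rs ! i"
    using factor_cring[OF assms(2)] .
  interpret hi: ring_hom_ring R "Rs ! i" "\<lambda>x. h x ! i"
    using proj_hom[OF assms(2)] .
  have closed: "b \<otimes>\<^bsub>Rs ! i\<^esub> h x ! i \<in> (\<lambda>x. h x ! i) ` I" if "b \<in> carrier (Rs ! i)" "x \<in> I" for b x
  proof -
    obtain y where "y \<in> carrier R" "h y ! i = b"
      using surj_coordinate[OF assms(2) \<open>b \<in> carrier (Rs ! i)\<close>] by blast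
    then show ?thesis
      using I.I_l_closed[OF \<open>x \<in> I\<close>, of y] \<open>x \<in> I\<close> by (intro image_eqI[of _ _ "y \<otimes> x"]) auto
  qed
  show ?thesis
  proof (rule idealI)
    show "subgroup ((\<lambda>x. h x ! i) ` I) (add_monoid (Rs ! i))"
    proof (rule S.add.subgroupI)
      show "(\<lambda>x. h x ! i) ` I \<noteq> {}"
        using I.zero_closed by blast
      show "\<ominus>\<^bsub>Rs ! i\<^esub> b \<in> (\<lambda>x. h x ! i) ` I" if "b \<in> (\<lambda>x. h x ! i) ` I" for b
        using that by (auto intro!: image_eqI[of _ _ "\<ominus> _"] simp flip: hi.hom_a_inv)
      show "b \<oplus>\<^bsub>Rs ! i\<^esub> c \<in> (\<lambda>x. h x ! i) ` I"
        if "b \<in> (\<lambda>x. h x ! i) ` I" "c \<in> (\<lambda>x. h x ! i) ` I" for b c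
        using that by (auto intro!: image_eqI[of _ _ "_ \<oplus> _"] simp flip: hi.hom_add)
    qed auto
    fix a b assume a: "a \<in> (\<lambda>x. h x ! i) ` I" and b: "b \<in> carrier (Rs ! i)"
    then show *: "b \<otimes>\<^bsub>Rs ! i\<^esub> a \<in> (\<lambda>x. h x ! i) ` I"
      using closed by auto
    have "a \<in> carrier (Rs ! i)"
      using a by auto
    then show "a \<otimes>\<^bsub>Rs ! i\<^esub> b \<in> (\<lambda>x. h x ! i) ` I"
      using * b S.m_comm by metis
  qed (rule S.ring_axioms)
qed

text \<open>An \<open>x\<close> whose coordinates all occur in \<open>I\<close> is assembled inside
  \<open>I\<close> one coordinate at a time, by means of the elements that project to the unit in
  one factor and to zero in the others.\<close>

lemma ideal_eq_product:
  assumes "ideal I R"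
  shows "I = {x \<in> carrier R. \<forall>i<m. h x ! i \<in> (\<lambda>x. h x ! i) ` I}" (is "I = ?P")
proof
  interpret I: ideal I R by fact
  show "I \<subseteq> ?P"
    using I.a_subset by auto
  show "?P \<subseteq> I"
  proof
    fix x assume x: "x \<in> ?P"
    have "\<exists>y\<in>I. \<forall>i<k. h y ! i = h x ! i" if "k \<le> m" for k
      using that
    proof (induction k)
      case 0
      then show ?case
        using I.zero_closed by blast
    next
      case (Suc k)
      then obtain y where y: "y \<in> I" "\<And>i. i < k \<Longrightarrow> h y ! i = h x ! i" by auto
      obtain z where z: "z \<in> I" "h z ! k = h x ! k"
        using x Suc.prems by (auto simp: image_iff Suc_le_eq)
      obtain e where e: "e \<in> carrier R"
        "\<And>i. i < m \<Longrightarrow> h e ! i = (if i = k then \<one>\<^bsub>Rs ! i\<^esub> else \<zero>\<^bsub>Rs ! i\<^esub>)"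
      proof -
        have "(if i = k then \<one>\<^bsub>Rs ! i\<^esub> else \<zero>\<^bsub>Rs ! i\<^esub>) \<in> carrier (Rs ! i)" if "i < m" for i
        proof -
          interpret S: cring "Rs ! i"
            using factor_cring[OF that] .
          show ?thesis
            using S.one_closed S.zero_closed by (cases "i = k") simp_all
        qed
        then show thesis
          using that ex_tuple[of "\<lambda>i. if i = k then \<one>\<^bsub>Rs ! i\<^esub> else \<zero>\<^bsub>Rs ! i\<^esub>"] by blast
      qed
      \<comment> \<open>Since \<open>h e\<close> is the unit at position \<open>k\<close> and zero
        elsewhere, \<open>w\<close> takes coordinate \<open>k\<close> from \<open>z\<close> and the
        others from \<open>y\<close>.\<close>
      define w where "w = y \<oplus> e \<otimes> (z \<ominus> y)"
      have carr: "y \<in> carrier R" "z \<in> carrier R"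
        using y(1) z(1) I.a_subset by auto
      have "z \<ominus> y \<in> I"
        using y(1) z(1) by (simp add: a_minus_def)
      then have "w \<in> I"
        using I.I_l_closed[OF _ e(1)] y(1) by (simp add: w_def)
      moreover have "h w ! i = h x ! i" if "i < Suc k" for i
      proof -
        have i: "i < m"
          using that Suc.prems by simp
        interpret S: cring "Rs ! i"
          using factor_cring[OF i] .
        interpret hi: ring_hom_ring R "Rs ! i" "\<lambda>x. h x ! i"
          using proj_hom[OF i] .
        have img: "h y ! i \<in> carrier (Rs ! i)" "h z ! i \<in> carrier (Rs ! i)"
          using carr by simp_all
        have "h w ! i = h y ! i \<oplus>\<^bsub>Rs ! i\<^esub> h e ! i \<otimes>\<^bsub>Rs ! i\<^esub> (h z ! i \<ominus>\<^bsub>Rs ! i\<^esub> h y ! i)"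
          using carr e(1) by (simp add: w_def a_minus_def)
        also have "\<dots> = h x ! i"
        proof (cases "i = k")
          case True
          have "h y ! i \<oplus>\<^bsub>Rs ! i\<^esub> \<one>\<^bsub>Rs ! i\<^esub> \<otimes>\<^bsub>Rs ! i\<^esub> (h z ! i \<ominus>\<^bsub>Rs ! i\<^esub> h y ! i) = h z ! i"
            using img by algebra
          then show ?thesis
            using True e(2)[OF i] z(2) by simp
        next
          case False
          have "h y ! i \<oplus>\<^bsub>Rs ! i\<^esub> \<zero>\<^bsub>Rs ! i\<^esub> \<otimes>\<^bsub>Rs ! i\<^esub> (h z ! i \<ominus>\<^bsub>Rs ! i\<^esub> h y ! i) = h y ! i"
            using img by algebra
          then show ?thesis
            using False e(2)[OF i] y(2)[of i] that by simp
        qed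
        finally show ?thesis .
      qed
      ultimately show ?case by blast
    qed
    then obtain y where "y \<in> I" "\<forall>i<m. h y ! i = h x ! i" by blast
    then show "x \<in> I"
      using h_eqI[of x y] x I.a_subset by auto
  qed
qed

lemma ideal_factorization_image:
  assumes "ideal I R"
  shows "ideal_factorization Rs h I (map (\<lambda>i. (\<lambda>x. h x ! i) ` I) [0..<m])"
proof -
  have "I \<subseteq> carrier R"
    using assms by (simp add: additive_subgroup.a_subset ideal.axioms(1))
  then show ?thesis
    using ideal_image[OF assms] ideal_eq_product[OF assms]
    by (subst ideal_factorization_iff) auto
qed

lemma ideal_tuple_nth:
  assumes "\<And>i. i < m \<Longrightarrow> ideal (A i) (Rs ! i)" "j < m"
  shows "(\<lambda>x. h x ! j) ` {x \<in> carrier R. \<forall>i<m. h x ! i \<in> A i} = A j"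
proof
  show "A j \<subseteq> (\<lambda>x. h x ! j) ` {x \<in> carrier R. \<forall>i<m. h x ! i \<in> A i}"
  proof
    fix b assume b: "b \<in> A j"
    let ?a = "\<lambda>i. if i = j then b else \<zero>\<^bsub>Rs ! i\<^esub>"
    have A: "?a i \<in> A i" if "i < m" for i
      using b additive_subgroup.zero_closed[OF ideal.axioms(1)[OF assms(1)[OF that]]] by simp
    have "?a i \<in> carrier (Rs ! i)" if "i < m" for i
      using ideal.Icarr[OF assms(1)[OF that] A[OF that]] .
    then obtain x where x: "x \<in> carrier R" "\<forall>i<m. h x ! i = ?a i"
      using ex_tuple[of ?a] by blast
    then show "b \<in> (\<lambda>x. h x ! j) ` {x \<in> carrier R. \<forall>i<m. h x ! i \<in> A i}"
      using A assms(2) by (intro image_eqI[of _ _ x]) auto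
  qed
qed (use assms(2) in auto)

text \<open>\<open>ideal_tuple_nth\<close> recovers each factor as a coordinate image of
  \<open>I\<close>, so the description operator in \<open>ideal_factors\<close> denotes this
  list.\<close>

lemma ideal_factorization_unique:
  assumes "ideal I R"
  shows "ideal_factorization Rs h I Is \<longleftrightarrow> Is = map (\<lambda>i. (\<lambda>x. h x ! i) ` I) [0..<m]"
proof
  assume "ideal_factorization Rs h I Is"
  then have "length Is = m" "\<And>i. i < m \<Longrightarrow> ideal (Is ! i) (Rs ! i)"
    "I = {x \<in> carrier R. \<forall>i<m. h x ! i \<in> Is ! i}"
    using ideal_factorization_iff[of I Is] additive_subgroup.a_subset[OF ideal.axioms(1)[OF assms]]
    by auto
  then show "Is = map (\<lambda>i. (\<lambda>x. h x ! i) ` I) [0..<m]"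
    using ideal_tuple_nth[of "\<lambda>i. Is ! i"] by (intro nth_equalityI) auto
qed (simp add: ideal_factorization_image[OF assms])

lemma ideal_factors_eq:
  assumes "ideal I R"
  shows "ideal_factors Rs h I = map (\<lambda>i. (\<lambda>x. h x ! i) ` I) [0..<m]"
  using ideal_factorization_unique[OF assms] by (simp add: ideal_factors_def)

lemma ideal_subset_iff:
  assumes "ideal I R" "ideal J R"
  shows "I \<subseteq> J \<longleftrightarrow> (\<forall>i<m. (\<lambda>x. h x ! i) ` I \<subseteq> (\<lambda>x. h x ! i) ` J)"
proof
  assume "\<forall>i<m. (\<lambda>x. h x ! i) ` I \<subseteq> (\<lambda>x. h x ! i) ` J"
  then have "{x \<in> carrier R. \<forall>i<m. h x ! i \<in> (\<lambda>x. h x ! i) ` I}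
    \<subseteq> {x \<in> carrier R. \<forall>i<m. h x ! i \<in> (\<lambda>x. h x ! i) ` J}"
    by (intro subsetI) (simp only: mem_Collect_eq, meson subsetD)
  then show "I \<subseteq> J"
    using ideal_eq_product[OF assms(1)] ideal_eq_product[OF assms(2)] by simp
qed auto

lemma image_zero:
  assumes "i < m"
  shows "(\<lambda>x. h x ! i) ` {\<zero>} = {\<zero>\<^bsub>Rs ! i\<^esub>}"
proof -
  interpret hi: ring_hom_ring R "Rs ! i" "\<lambda>x. h x ! i"
    using proj_hom[OF assms] .
  show ?thesis by simp
qed

lemma image_carrier:
  assumes "i < m"
  shows "(\<lambda>x. h x ! i) ` carrier R = carrier (Rs ! i)"
proof -
  interpret hi: ring_hom_ring R "Rs ! i" "\<lambda>x. h x ! i"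
    using proj_hom[OF assms] .
  show ?thesis
    using surj_coordinate[OF assms] by (fastforce simp: image_iff)
qed

section \<open>Zero-one ideals and their complements\<close>

lemma zero_one_ideals_iff:
  "I \<in> zero_one_ideals R Rs h \<longleftrightarrow> I \<in> pverts (inclusion_ideal_graph R) \<and>
    (\<forall>i<m. (\<lambda>x. h x ! i) ` I = {\<zero>\<^bsub>Rs ! i\<^esub>} \<or> (\<lambda>x. h x ! i) ` I = carrier (Rs ! i))"
proof -
  have "ideal I R" if "I \<in> pverts (inclusion_ideal_graph R)"
    using that by (simp add: inclusion_ideal_graph_def Let_def)
  then have "ideal_factorization Rs h I Is \<longleftrightarrow> Is = map (\<lambda>i. (\<lambda>x. h x ! i) ` I) [0..<m]"
    if "I \<in> pverts (inclusion_ideal_graph R)" for Is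
    using ideal_factorization_unique that by blast
  then show ?thesis
    by (simp add: zero_one_ideals_def len cong: conj_cong)
qed

lemma ideal_compl_eq:
  assumes "ideal J R"
  shows "ideal_compl R Rs h J = {x \<in> carrier R. \<forall>i<m. h x ! i \<in>
    (if (\<lambda>x. h x ! i) ` J = {\<zero>\<^bsub>Rs ! i\<^esub>} then carrier (Rs ! i) else {\<zero>\<^bsub>Rs ! i\<^esub>})}"
  unfolding ideal_compl_def ideal_factors_eq[OF assms] listset_iff
  using len length_h by (intro Collect_cong conj_cong refl) simp

text \<open>The formula covers every ideal \<open>J\<close>, as \<open>ideal_compl\<close> sends
  each nonzero factor to zero; it gives a complement in the order only if each factor of
  \<open>J\<close> is zero or the whole ring.\<close>

lemma ideal_compl:
  assumes "ideal J R"
  shows "ideal (ideal_compl R Rs h J) R"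
    and "i < m \<Longrightarrow> (\<lambda>x. h x ! i) ` ideal_compl R Rs h J =
      (if (\<lambda>x. h x ! i) ` J = {\<zero>\<^bsub>Rs ! i\<^esub>} then carrier (Rs ! i) else {\<zero>\<^bsub>Rs ! i\<^esub>})"
proof -
  let ?A = "\<lambda>i. if (\<lambda>x. h x ! i) ` J = {\<zero>\<^bsub>Rs ! i\<^esub>} then carrier (Rs ! i) else {\<zero>\<^bsub>Rs ! i\<^esub>}"
  have "ideal (?A j) (Rs ! j)" if "j < m" for j
    using factor_cring[OF that] by (simp add: ring.zeroideal ring.oneideal cring.axioms(1))
  then show "ideal (ideal_compl R Rs h J) R"
    and "i < m \<Longrightarrow> (\<lambda>x. h x ! i) ` ideal_compl R Rs h J = ?A i"
    unfolding ideal_compl_eq[OF assms]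
    using ideal_tuple[of ?A] ideal_tuple_nth[of ?A i] by blast+
qed

end

section \<open>The strong resolving graph\<close>

theorem lemma3p3:
  fixes m :: nat
    and R :: "('a, 'k) ring_scheme"
    and Rs :: "('b, 'n) ring_scheme list"
    and h :: "'a \<Rightarrow> 'b list"
  assumes "m \<ge> 2"
    and "length Rs = m"
    and "\<And>i. i < m \<Longrightarrow> local_ring (Rs ! i)"
    and "\<And>i. i < m \<Longrightarrow> artinian_ring (Rs ! i)"
    and "\<And>i. i < m \<Longrightarrow> principal_ideal_ring (Rs ! i)"
    and "\<And>i. i < m \<Longrightarrow> \<not> field (Rs ! i)"
    and "cring R"
    and "h \<in> ring_iso R (RDirProd_list Rs)"
  shows
    "let G = inclusion_ideal_graph R;
         S = strong_resolving_graph G;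
         M = zero_one_ideals R Rs h;
         c = ideal_compl R Rs h
     in pverts G = pverts S \<and>
        M \<subseteq> pverts S \<and>
        (\<forall>I \<in> M. \<forall>J \<in> M. I \<noteq> J \<longrightarrow>
           ((I, J) \<in> parcs S \<longleftrightarrow> I = c J \<or> (I, J) \<notin> parcs G \<and> (I, c J) \<notin> parcs G)) \<and>
        (\<forall>I \<in> pverts S - M. \<forall>J \<in> pverts S - M. I \<noteq> J \<longrightarrow>
           ((I, J) \<in> parcs S \<longleftrightarrow> (I, J) \<notin> parcs G)) \<and>
        (\<forall>I \<in> pverts S - M. \<forall>J \<in> M.
           ((I, J) \<in> parcs S \<longleftrightarrow> (I, J) \<notin> parcs G \<and> (I, c J) \<notin> parcs G))"
proof -
  interpret P: ring_product_iso R m Rs h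
    using assms
    by (intro ring_product_iso.intro ring_product_iso_axioms.intro) (auto simp: local_ring_def)
  let ?f = "\<lambda>I i. (\<lambda>x. h x ! i) ` I"
  have chain_ring: "local_artinian_pir (Rs ! i)" if "i < m" for i
    using assms(3-5)[OF that] by (simp add: local_artinian_pir_def)
  \<comment> \<open>The ideals of \<open>R\<close> under inclusion form the product of the ideal
    chains of the factors, with \<open>?f I i\<close> as factor at position
    \<open>i\<close>.\<close>
  interpret L: chain_product "{I. ideal I R}" m ?f "\<lambda>i. {A. ideal A (Rs ! i)}"
    "\<lambda>i. {\<zero>\<^bsub>Rs ! i\<^esub>}" "\<lambda>i. carrier (Rs ! i)"
  proof unfold_locales
    show "2 \<le> m" by fact
    show "I \<subseteq> J \<longleftrightarrow> (\<forall>i<m. ?f I i \<subseteq> ?f J i)" if "I \<in> {I. ideal I R}" "J \<in> {I. ideal I R}" for I J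
      using P.ideal_subset_iff that by simp
    show "?f I i \<in> {A. ideal A (Rs ! i)}" if "I \<in> {I. ideal I R}" "i < m" for I i
      using P.ideal_image that by simp
    show "\<exists>I\<in>{I. ideal I R}. \<forall>i<m. ?f I i = A i" if "\<And>i. i < m \<Longrightarrow> A i \<in> {A. ideal A (Rs ! i)}" for A
      using P.ideal_tuple[of A] P.ideal_tuple_nth[of A] that
      by (intro bexI[of _ "{x \<in> carrier R. \<forall>i<m. h x ! i \<in> A i}"]) auto
  next
    fix i assume i: "i < m"
    then interpret S: local_artinian_pir "Rs ! i"
      using chain_ring by blast
    show "{\<zero>\<^bsub>Rs ! i\<^esub>} \<in> {A. ideal A (Rs ! i)}" "carrier (Rs ! i) \<in> {A. ideal A (Rs ! i)}"
      using S.zeroideal S.oneideal by simp_all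
    show "\<exists>A\<in>{A. ideal A (Rs ! i)}. A \<noteq> {\<zero>\<^bsub>Rs ! i\<^esub>} \<and> A \<noteq> carrier (Rs ! i)"
      using S.ex_nontrivial_ideal assms(6)[OF i] by auto
    fix A assume A: "A \<in> {A. ideal A (Rs ! i)}"
    then interpret A: ideal A "Rs ! i" by simp
    show "{\<zero>\<^bsub>Rs ! i\<^esub>} \<subseteq> A" "A \<subseteq> carrier (Rs ! i)"
      using A.zero_closed A.a_subset by simp_all
    show "A \<subseteq> B \<or> B \<subseteq> A" if "B \<in> {A. ideal A (Rs ! i)}" for B
      using S.ideals_chain A that by simp
  qed
  \<comment> \<open>The two excluded ideals are the bottom and the top of the product, so
    \<open>L.V\<close> is the vertex set of the inclusion ideal graph.\<close>
  have zero: "I \<noteq> {\<zero>\<^bsub>R\<^esub>} \<longleftrightarrow> (\<exists>i<m. ?f I i \<noteq> {\<zero>\<^bsub>Rs ! i\<^esub>})" if "ideal I R" for I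
    using L.eqI[of I "{\<zero>\<^bsub>R\<^esub>}"] that P.image_zero P.R.zeroideal by blast
  have one: "I \<noteq> carrier R \<longleftrightarrow> (\<exists>i<m. ?f I i \<noteq> carrier (Rs ! i))" if "ideal I R" for I
    using L.eqI[of I "carrier R"] that P.image_carrier P.R.oneideal by blast
  have V: "L.V = {I. ideal I R \<and> I \<noteq> {\<zero>\<^bsub>R\<^esub>} \<and> I \<noteq> carrier R}"
  proof (rule Set.set_eqI)
    show "I \<in> L.V \<longleftrightarrow> I \<in> {I. ideal I R \<and> I \<noteq> {\<zero>\<^bsub>R\<^esub>} \<and> I \<noteq> carrier R}" for I
      unfolding L.V_def mem_Collect_eq using zero[of I] one[of I] by argo
  qed
  have G: "inclusion_ideal_graph R = L.\<Gamma>"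
    by (simp add: inclusion_ideal_graph_def comparability_graph_def V)
  have M: "I \<in> zero_one_ideals R Rs h \<longleftrightarrow> I \<in> L.V \<and> L.extremal I" for I
    by (simp add: P.zero_one_ideals_iff G L.extremal_def)
  \<comment> \<open>On \<open>M\<close> the complement of ideals is the complement in the product of
    chains.\<close>
  have c: "ideal_compl R Rs h J \<in> L.V" "L.complementary J (ideal_compl R Rs h J)"
    if J: "J \<in> L.V" "L.extremal J" for J
  proof -
    have "ideal J R"
      using L.V_L[OF J(1)] by simp
    show "L.complementary J (ideal_compl R Rs h J)"
      using J(2) P.ideal_compl(2)[OF \<open>ideal J R\<close>] by (auto simp: L.complementary_def L.extremal_def)
    then show "ideal_compl R Rs h J \<in> L.V"
      using L.complementary_V[OF J(1)] P.ideal_compl(1)[OF \<open>ideal J R\<close>] by simp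
  qed
  \<comment> \<open>Every vertex has a mutually maximally distant partner, so the strong resolving
    graph loses no vertex.\<close>
  have S: "pverts (strong_resolving_graph L.\<Gamma>) = L.V"
    "(I, J) \<in> parcs (strong_resolving_graph L.\<Gamma>) \<longleftrightarrow> mutually_maximally_distant L.\<Gamma> I J" for I J
    using L.ex_mutually_maximally_distant by (auto simp: strong_resolving_graph_def)
  show ?thesis
    unfolding Let_def G S
  proof (intro conjI ballI impI)
    show "pverts L.\<Gamma> = L.V" by simp
    show "zero_one_ideals R Rs h \<subseteq> L.V"
      using M by blast
  next
    fix I J
    assume "I \<in> zero_one_ideals R Rs h" "J \<in> zero_one_ideals R Rs h" "I \<noteq> J"
    then show "mutually_maximally_distant L.\<Gamma> I J \<longleftrightarrow>
      I = ideal_compl R Rs h J \<or> (I, J) \<notin> parcs L.\<Gamma> \<and> (I, ideal_compl R Rs h J) \<notin> parcs L.\<Gamma>"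
      unfolding M using c[of I] c[of J] L.mutually_maximally_distant_extremal[of I J]
      by metis
  next
    fix I J
    assume "I \<in> L.V - zero_one_ideals R Rs h" "J \<in> L.V - zero_one_ideals R Rs h" "I \<noteq> J"
    then show "mutually_maximally_distant L.\<Gamma> I J \<longleftrightarrow> (I, J) \<notin> parcs L.\<Gamma>"
      using L.mutually_maximally_distant_non_extremal[of I J] by (simp only: Diff_iff M) metis
  next
    fix I J
    assume "I \<in> L.V - zero_one_ideals R Rs h" "J \<in> zero_one_ideals R Rs h"
    then show "mutually_maximally_distant L.\<Gamma> I J \<longleftrightarrow>
      (I, J) \<notin> parcs L.\<Gamma> \<and> (I, ideal_compl R Rs h J) \<notin> parcs L.\<Gamma>"
      using L.mutually_maximally_distant_mixed[of I J "ideal_compl R Rs h J"] c[of J]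
      by (simp only: Diff_iff M) metis
  qed
qed

end
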